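(* Let $f\in\mathcal W_\infty$ and let $A=\{a_n:n\in\mathbb N\}$ be a faithfully indexed sequence of elements of a topological group. Then the following conditions are equivalent: (i) $A$ is unconditionally $f$-Cauchy productive; (ii) for every injection $\varphi:\mathbb N\to\mathbb N$, the sequence $\{a_{\varphi(n)}:n\in\mathbb N\}$ is $(f\circ\varphi)$-Cauchy productive. Likewise, the following conditions are equivalent: (i') $A$ is unconditionally $f$-productive; (ii') for every injection $\varphi:\mathbb N\to\mathbb N$, the sequence $\{a_{\varphi(n)}:n\in\mathbb N\}$ is $(f\circ\varphi)$-productive.
   Context: All topological groups are Hausdorff; $\mathbb N=\{0,1,2,\dots\}$; $\omega$ is the first infinite ordinal, $\omega+1=\mathbb N\cup\{\omega\}$, $n<\omega$ for $n\in\mathbb N$. $\mathcal W_\infty$ is the set of all functions $f:\mathbb N\to(\omega+1)\setminus\{0\}$. Faithfully indexed means $a_n\ne a_m$ for $n\ne m$. A sequence $\{x_n\}$ in a topological group is left Cauchy if for every neighbourhood $U$ of the identity there is $k$ with $x_l^{-1}x_m\in U$ for all $l,m\ge k$. Products are ordered: $\prod_{n=0}^m b_n=b_0b_1\cdots b_m$. A sequence $\{b_n:n\in\mathbb N\}$ in a topological group $G$ is Cauchy productive (productive) if $\{\prod_{n=0}^m b_n:m\in\mathbb N\}$ is left Cauchy (respectively, converges to some element of $G$). For $f\in\mathcal W_\infty$, a faithfully indexed sequence $\{a_n:n\in\mathbb N\}$ in $G$ is $f$-Cauchy productive ($f$-productive) if $\{a_n^{z(n)}:n\in\mathbb N\}$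 is Cauchy productive (respectively, productive) for every $z:\mathbb N\to\mathbb Z$ with $|z(n)|\le f(n)$ for all $n$. It is unconditionally $f$-Cauchy productive (unconditionally $f$-productive) if $\{a_{\varphi(n)}:n\in\mathbb N\}$ is $(f\circ\varphi)$-Cauchy productive (respectively, $(f\circ\varphi)$-productive) for every bijection $\varphi:\mathbb N\to\mathbb N$. *)

theory Defs
  imports "HOL-Algebra.Group" "HOL-Analysis.Abstract_Topological_Spaces" "HOL-Library.Extended_Nat"
begin

locale hausdorff_topological_group = group G for G (structure) +
  fixes T :: "'a topology"
  assumes topspace_eq_carrier: "topspace T = carrier G"
    and Hausdorff: "Hausdorff_space T"
    and continuous_mult: "continuous_map (prod_topology T T) T (\<lambda>(x, y). x \<otimes> y)"
    and continuous_inv: "continuous_map T T (\<lambda>x. inv x)"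

text \<open>The nowhere zero functions $\mathbb N \to \omega+1$; the ordinal $\omega$ is
  the value \<open>\<infinity>\<close> of type \<^typ>\<open>enat\<close>.\<close>

definition W_infinity :: "(nat \<Rightarrow> enat) set" where
  "W_infinity = {f. \<forall>n. f n \<noteq> 0}"

text \<open>Neighbourhoods of the identity are not required to be open.\<close>

definition left_Cauchy :: "('a, 'b) monoid_scheme \<Rightarrow> 'a topology \<Rightarrow> (nat \<Rightarrow> 'a) \<Rightarrow> bool" where
  "left_Cauchy G T x \<longleftrightarrow>
    (\<forall>U. U \<subseteq> carrier G \<and> (\<exists>V. openin T V \<and> \<one>\<^bsub>G\<^esub> \<in> V \<and> V \<subseteq> U) \<longrightarrow>
      (\<exists>k. \<forall>l\<ge>k. \<forall>m\<ge>k. inv\<^bsub>G\<^esub> (x l) \<otimes>\<^bsub>G\<^esub> x m \<in> U))"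

text \<open>The ordered product $b_0 b_1 \cdots b_m$, with both end points included.\<close>

primrec ordered_prod :: "('a, 'b) monoid_scheme \<Rightarrow> (nat \<Rightarrow> 'a) \<Rightarrow> nat \<Rightarrow> 'a" where
  "ordered_prod G b 0 = b 0"
| "ordered_prod G b (Suc m) = ordered_prod G b m \<otimes>\<^bsub>G\<^esub> b (Suc m)"

definition Cauchy_productive ::
    "('a, 'b) monoid_scheme \<Rightarrow> 'a topology \<Rightarrow> (nat \<Rightarrow> 'a) \<Rightarrow> bool" where
  "Cauchy_productive G T b \<longleftrightarrow> left_Cauchy G T (\<lambda>m. ordered_prod G b m)"

definition productive ::
    "('a, 'b) monoid_scheme \<Rightarrow> 'a topology \<Rightarrow> (nat \<Rightarrow> 'a) \<Rightarrow> bool" where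
  "productive G T b \<longleftrightarrow>
    (\<exists>g\<in>carrier G. limitin T (\<lambda>m. ordered_prod G b m) g sequentially)"

text \<open>The following notions are meant for \<open>f \<in> W_infinity\<close> and for faithfully indexed
  (that is, injective) sequences \<open>a\<close> in \<open>carrier G\<close>; these side conditions are not part of the
  predicates. They are inherited by \<open>f \<circ> \<phi>\<close> and \<open>a \<circ> \<phi>\<close> for every injection \<open>\<phi>\<close>.\<close>

definition f_Cauchy_productive ::
    "('a, 'b) monoid_scheme \<Rightarrow> 'a topology \<Rightarrow> (nat \<Rightarrow> enat) \<Rightarrow> (nat \<Rightarrow> 'a) \<Rightarrow> bool" where
  "f_Cauchy_productive G T f a \<longleftrightarrow>
    (\<forall>z :: nat \<Rightarrow> int. (\<forall>n. enat (nat \<bar>z n\<bar>) \<le> f n) \<longrightarrow>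
      Cauchy_productive G T (\<lambda>n. a n [^]\<^bsub>G\<^esub> z n))"

definition f_productive ::
    "('a, 'b) monoid_scheme \<Rightarrow> 'a topology \<Rightarrow> (nat \<Rightarrow> enat) \<Rightarrow> (nat \<Rightarrow> 'a) \<Rightarrow> bool" where
  "f_productive G T f a \<longleftrightarrow>
    (\<forall>z :: nat \<Rightarrow> int. (\<forall>n. enat (nat \<bar>z n\<bar>) \<le> f n) \<longrightarrow>
      productive G T (\<lambda>n. a n [^]\<^bsub>G\<^esub> z n))"

definition unconditionally_f_Cauchy_productive ::
    "('a, 'b) monoid_scheme \<Rightarrow> 'a topology \<Rightarrow> (nat \<Rightarrow> enat) \<Rightarrow> (nat \<Rightarrow> 'a) \<Rightarrow> bool" where
  "unconditionally_f_Cauchy_productive G T f a \<longleftrightarrow>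
    (\<forall>\<phi> :: nat \<Rightarrow> nat. bij \<phi> \<longrightarrow> f_Cauchy_productive G T (f \<circ> \<phi>) (a \<circ> \<phi>))"

definition unconditionally_f_productive ::
    "('a, 'b) monoid_scheme \<Rightarrow> 'a topology \<Rightarrow> (nat \<Rightarrow> enat) \<Rightarrow> (nat \<Rightarrow> 'a) \<Rightarrow> bool" where
  "unconditionally_f_productive G T f a \<longleftrightarrow>
    (\<forall>\<phi> :: nat \<Rightarrow> nat. bij \<phi> \<longrightarrow> f_productive G T (f \<circ> \<phi>) (a \<circ> \<phi>))"

end

theory Submission
  imports Defs "HOL-Library.Infinite_Set"
begin

text \<open>Any injection is obtained from a permutation of the naturals by deleting entries. Extending the
  exponents by zero at the deleted entries, the products along the injection form a subsequence
  of the products along the permutation.\<close>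

text \<open>List the tagged set \<open>K\<close> of the numbers \<open>2 * n\<close> (standing for \<open>\<phi> n\<close>) and \<open>2 * c + 1\<close>
  (standing for an element \<open>c\<close> outside the range of \<open>\<phi>\<close>) increasingly; this treats finite and
  infinite complements of the range uniformly.\<close>

lemma inj_extends_to_bij:
  fixes \<phi> :: "nat \<Rightarrow> nat"
  assumes "inj \<phi>"
  obtains \<psi> s :: "nat \<Rightarrow> nat" where "bij \<psi>" "strict_mono s" "\<And>n. \<psi> (s n) = \<phi> n"
proof -
  define K where "K = range (\<lambda>n. 2 * n) \<union> (\<lambda>c. 2 * c + 1) ` (- range \<phi>)"
  define h where "h k = (if even k then \<phi> (k div 2) else k div 2)" for k
  have h_even: "h (2 * n) = \<phi> n" for n by (simp add: h_def)
  have h_odd: "h (2 * c + 1) = c" for c by (simp add: h_def)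
  define e where "e = enumerate K"
  have inf: "infinite K"
  proof -
    have "inj (\<lambda>n::nat. 2 * n)" by (rule injI) simp
    then show ?thesis unfolding K_def infinite_Un using range_inj_infinite by blast
  qed
  have e: "bij_betw e UNIV K"
    unfolding e_def using inf by (rule bij_enumerate)
  have mono_e: "strict_mono e"
    unfolding e_def using inf by (rule strict_mono_enumerate)
  have "inj_on h K"
  proof (rule inj_onI)
    fix x y
    assume "x \<in> K" "y \<in> K" and eq: "h x = h y"
    \<comment> \<open>In the mixed cases \<open>h\<close> would give a common value both inside and
      outside \<open>range \<phi>\<close>, a contradiction.\<close>
    then consider n n' where "x = 2 * n" "y = 2 * n'"
      | n c where "x = 2 * n" "y = 2 * c + 1" "c \<notin> range \<phi>"
      | c n where "x = 2 * c + 1" "y = 2 * n" "c \<notin> range \<phi>"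
      | c c' where "x = 2 * c + 1" "y = 2 * c' + 1"
      unfolding K_def by blast
    then show "x = y"
    proof cases
      case 1
      then show ?thesis using eq assms by (simp add: h_even inj_eq)
    next
      case 2
      then show ?thesis using eq by (metis h_even h_odd rangeI)
    next
      case 3
      then show ?thesis using eq by (metis h_even h_odd rangeI)
    next
      case 4
      then show ?thesis using eq by (simp only: h_odd)
    qed
  qed
  moreover have "h ` K = UNIV"
  proof (intro equalityI subsetI)
    fix m
    show "m \<in> h ` K"
    proof (cases "m \<in> range \<phi>")
      case True
      then obtain n where "m = h (2 * n)" by (metis h_even rangeE)
      moreover have "2 * n \<in> K" unfolding K_def by blast
      ultimately show ?thesis by blast
    next
      case False
      then have "2 * m + 1 \<in> K" unfolding K_def by blast
      then show ?thesis by (metis h_odd imageI)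
    qed
  qed simp
  ultimately have h: "bij_betw h K UNIV" by (simp add: bij_betw_def)
  \<comment> \<open>\<open>s n\<close> is the position of the tag \<open>2 * n\<close> in the
    listing of \<open>K\<close>. The tags increase with \<open>n\<close> and \<open>e\<close> is
    increasing, so the positions increase too, even when \<phi> itself is not monotone.\<close>
  define s where "s n = the_inv_into UNIV e (2 * n)" for n
  have es: "e (s n) = 2 * n" for n
    unfolding s_def by (rule f_the_inv_into_f_bij_betw[OF e]) (auto simp: K_def)
  have "strict_mono s"
  proof (rule strict_monoI)
    fix m n :: nat
    assume "m < n"
    then have "e (s m) < e (s n)" by (simp add: es)
    then show "s m < s n" using mono_e by (simp add: strict_mono_less)
  qed
  moreover have "bij (h \<circ> e)" using bij_betw_trans[OF e h] .
  moreover have "(h \<circ> e) (s n) = \<phi> n" for n by (simp add: es h_even)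
  ultimately show ?thesis by (intro that)
qed

context monoid
begin

lemma ordered_prod_closed:
  assumes "\<And>n. b n \<in> carrier G"
  shows "ordered_prod G b n \<in> carrier G"
  using assms by (induction n) auto

lemma ordered_prod_eq_of_ones_after:
  assumes "\<And>n. b n \<in> carrier G" and "i \<le> j" and "\<And>k. i < k \<Longrightarrow> k \<le> j \<Longrightarrow> b k = \<one>"
  shows "ordered_prod G b j = ordered_prod G b i"
  using assms(2,3)
proof (induction j rule: dec_induct)
  case (step j)
  then show ?case using ordered_prod_closed[OF assms(1)] by simp
qed simp

text \<open>Treats a leading block of ones. An ordered product always starts with the factor
  \<open>b 0\<close>, so there is no empty product to compare with and this case is separate from
  the preceding one.\<close>

lemma ordered_prod_eq_last:
  assumes "\<And>n. b n \<in> carrier G" and "\<And>k. k < j \<Longrightarrow> b k = \<one>"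
  shows "ordered_prod G b j = b j"
proof (cases j)
  case (Suc i)
  have "ordered_prod G b i = b 0"
    using ordered_prod_eq_of_ones_after[OF assms(1), of 0 i] assms(2) Suc by simp
  then show ?thesis using assms Suc by simp
qed simp

text \<open>Only trivial factors stand before \<open>s 0\<close> and between consecutive values of
  \<open>s\<close>, so the product changes only at indices in \<open>range s\<close>.\<close>

lemma ordered_prod_subseq:
  assumes b: "\<And>n. b n \<in> carrier G" and s: "strict_mono s"
    and one: "\<And>k. k \<notin> range s \<Longrightarrow> b k = \<one>"
  shows "ordered_prod G b (s n) = ordered_prod G (b \<circ> s) n"
proof (induction n)
  case 0
  have "k \<notin> range s" if "k < s 0" for k
    using that s by (auto simp: strict_mono_less)
  then show ?case using ordered_prod_eq_last[OF b] one by simp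
next
  case (Suc n)
  \<comment> \<open>\<open>j\<close> is the last index before \<open>s (Suc n)\<close>; it equals
    \<open>s n\<close> when there is no gap. The product keeps its value from \<open>s n\<close> up
    to \<open>j\<close>.\<close>
  obtain j where j: "s (Suc n) = Suc j" "s n \<le> j"
    using strict_monoD[OF s lessI[of n]] by (cases "s (Suc n)") auto
  have "k \<notin> range s" if "s n < k" "k \<le> j" for k
  proof
    assume "k \<in> range s"
    then obtain i where "k = s i" by blast
    with that j have "s n < s i" "s i < s (Suc n)" by auto
    then show False using s by (simp add: strict_mono_less)
  qed
  then have "ordered_prod G b j = ordered_prod G b (s n)"
    by (intro ordered_prod_eq_of_ones_after[OF b j(2)] one)
  then show ?case using Suc j by simp
qed

end

text \<open>As \<open>n \<le> s n\<close>, the same threshold \<open>k\<close> serves for the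
  subsequence.\<close>

lemma left_Cauchy_subseq:
  assumes "left_Cauchy G T x" and "strict_mono s"
  shows "left_Cauchy G T (x \<circ> s)"
  unfolding left_Cauchy_def
proof (intro allI impI)
  fix U
  assume "U \<subseteq> carrier G \<and> (\<exists>V. openin T V \<and> \<one>\<^bsub>G\<^esub> \<in> V \<and> V \<subseteq> U)"
  with assms(1) obtain k where
    k: "\<forall>l\<ge>k. \<forall>m\<ge>k. inv\<^bsub>G\<^esub> (x l) \<otimes>\<^bsub>G\<^esub> x m \<in> U"
    unfolding left_Cauchy_def by meson
  have "k \<le> s n" if "k \<le> n" for n
    using that seq_suble[OF assms(2), of n] by (rule order_trans)
  with k show "\<exists>k. \<forall>l\<ge>k. \<forall>m\<ge>k. inv\<^bsub>G\<^esub> ((x \<circ> s) l) \<otimes>\<^bsub>G\<^esub> (x \<circ> s) m \<in> U"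
    by (intro exI[of _ k]) simp
qed

lemma Cauchy_productive_subseq:
  assumes "monoid G" and "\<And>n. b n \<in> carrier G" and "strict_mono s"
    and "\<And>k. k \<notin> range s \<Longrightarrow> b k = \<one>\<^bsub>G\<^esub>"
    and "Cauchy_productive G T b"
  shows "Cauchy_productive G T (b \<circ> s)"
proof -
  have "ordered_prod G b \<circ> s = ordered_prod G (b \<circ> s)"
    using monoid.ordered_prod_subseq[OF assms(1-4)] by (intro ext) (simp only: comp_apply)
  then show ?thesis
    using left_Cauchy_subseq[OF _ assms(3), of G T "ordered_prod G b"] assms(5)
    unfolding Cauchy_productive_def by simp
qed

lemma productive_subseq:
  assumes "monoid G" and "\<And>n. b n \<in> carrier G" and "strict_mono s"
    and "\<And>k. k \<notin> range s \<Longrightarrow> b k = \<one>\<^bsub>G\<^esub>"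
    and "productive G T b"
  shows "productive G T (b \<circ> s)"
proof -
  have "ordered_prod G b \<circ> s = ordered_prod G (b \<circ> s)"
    using monoid.ordered_prod_subseq[OF assms(1-4)] by (intro ext) (simp only: comp_apply)
  then show ?thesis
    using limitin_subsequence[OF assms(3), of T "ordered_prod G b"] assms(5)
    unfolding productive_def by metis
qed

text \<open>The predicate \<open>P\<close> stands for Cauchy productivity or productivity, so that
  one argument covers both equivalences; \<open>subseq\<close> says that \<open>P\<close> survives
  the deletion of trivial factors.\<close>

lemma bij_iff_inj_of_subseq_closed:
  fixes f :: "nat \<Rightarrow> enat" and P :: "(nat \<Rightarrow> 'a) \<Rightarrow> bool"
  assumes G: "group G" and a: "\<And>n. a n \<in> carrier G"
    and subseq: "\<And>b s. (\<And>n. b n \<in> carrier G) \<Longrightarrow> strict_mono s \<Longrightarrow>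
      (\<And>k. k \<notin> range s \<Longrightarrow> b k = \<one>\<^bsub>G\<^esub>) \<Longrightarrow> P b \<Longrightarrow> P (b \<circ> s)"
  shows "(\<forall>\<phi> :: nat \<Rightarrow> nat. bij \<phi> \<longrightarrow> (\<forall>z :: nat \<Rightarrow> int.
            (\<forall>n. enat (nat \<bar>z n\<bar>) \<le> (f \<circ> \<phi>) n) \<longrightarrow> P (\<lambda>n. (a \<circ> \<phi>) n [^]\<^bsub>G\<^esub> z n))) \<longleftrightarrow>
         (\<forall>\<phi> :: nat \<Rightarrow> nat. inj \<phi> \<longrightarrow> (\<forall>z :: nat \<Rightarrow> int.
            (\<forall>n. enat (nat \<bar>z n\<bar>) \<le> (f \<circ> \<phi>) n) \<longrightarrow> P (\<lambda>n. (a \<circ> \<phi>) n [^]\<^bsub>G\<^esub> z n)))"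
    (is "?B \<longleftrightarrow> ?I")
proof
  assume B: ?B
  show ?I
  proof (intro allI impI)
    fix \<phi> :: "nat \<Rightarrow> nat" and z :: "nat \<Rightarrow> int"
    assume "inj \<phi>" and z: "\<forall>n. enat (nat \<bar>z n\<bar>) \<le> (f \<circ> \<phi>) n"
    obtain \<psi> s :: "nat \<Rightarrow> nat"
      where \<psi>: "bij \<psi>" and s: "strict_mono s" and \<psi>s: "\<And>n. \<psi> (s n) = \<phi> n"
      by (rule inj_extends_to_bij[OF \<open>inj \<phi>\<close>]) (rule that)
    \<comment> \<open>The exponents \<open>z\<close> are moved to the positions \<open>s n\<close>.
      The default 0 satisfies every bound given by \<open>f\<close> and makes each remaining factor
      the identity, as \<open>subseq\<close> requires.\<close>
    define w where "w k = (if k \<in> range s then z (the_inv s k) else 0)" for k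
    have ws: "w (s n) = z n" for n
      using the_inv_f_f[OF strict_mono_imp_inj_on[OF s]] by (simp add: w_def)
    have "enat (nat \<bar>w k\<bar>) \<le> (f \<circ> \<psi>) k" for k
    proof (cases "k \<in> range s")
      case True
      then obtain n where "k = s n" by blast
      then show ?thesis using spec[OF z, of n] by (simp only: ws \<psi>s comp_apply)
    next
      case False
      then show ?thesis by (simp add: w_def zero_enat_def[symmetric])
    qed
    with B \<psi> have "P (\<lambda>n. (a \<circ> \<psi>) n [^]\<^bsub>G\<^esub> w n)" by blast
    then have "P ((\<lambda>n. (a \<circ> \<psi>) n [^]\<^bsub>G\<^esub> w n) \<circ> s)"
      using a by (intro subseq s) (simp_all add: w_def group.int_pow_closed[OF G])
    moreover have "(\<lambda>n. (a \<circ> \<psi>) n [^]\<^bsub>G\<^esub> w n) \<circ> s = (\<lambda>n. (a \<circ> \<phi>) n [^]\<^bsub>G\<^esub> z n)"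
      by (intro ext) (simp only: comp_apply ws \<psi>s)
    ultimately show "P (\<lambda>n. (a \<circ> \<phi>) n [^]\<^bsub>G\<^esub> z n)" by (simp only:)
  qed
qed (simp add: bij_is_inj)

theorem lemma4p3:
  fixes G :: "('a, 'b) monoid_scheme" and T :: "'a topology"
    and f :: "nat \<Rightarrow> enat" and a :: "nat \<Rightarrow> 'a"
  assumes "hausdorff_topological_group G T"
    and "f \<in> W_infinity"
    and "\<And>n. a n \<in> carrier G"
    and "inj a"
  shows "(unconditionally_f_Cauchy_productive G T f a \<longleftrightarrow>
            (\<forall>\<phi> :: nat \<Rightarrow> nat. inj \<phi> \<longrightarrow> f_Cauchy_productive G T (f \<circ> \<phi>) (a \<circ> \<phi>))) \<and>
         (unconditionally_f_productive G T f a \<longleftrightarrow>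
            (\<forall>\<phi> :: nat \<Rightarrow> nat. inj \<phi> \<longrightarrow> f_productive G T (f \<circ> \<phi>) (a \<circ> \<phi>)))"
proof -
  have G: "group G"
    using assms(1) by (rule hausdorff_topological_group.axioms(1))
  then have M: "monoid G" by (rule group.is_monoid)
  show ?thesis
    unfolding unconditionally_f_Cauchy_productive_def unconditionally_f_productive_def
      f_Cauchy_productive_def f_productive_def
    \<comment> \<open>\<open>P\<close> becomes \<open>Cauchy_productive G T\<close> in the first
      equivalence and \<open>productive G T\<close> in the second.\<close>
    by (intro conjI bij_iff_inj_of_subseq_closed G assms(3)
        Cauchy_productive_subseq[OF M] productive_subseq[OF M])
qed

end
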